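(* If $\Sigma$ is a complete fan in $N_{\mathbb R}$, then any psh function on $N_\Sigma$ is constant.
   Context: $N$ is a free abelian group of finite rank $n$, $N_{\mathbb R}=N\otimes\mathbb R$, $\mathbb R_{-\infty}=\mathbb R\cup\{-\infty\}$ topologized so that $\exp:\mathbb R_{-\infty}\to[0,\infty)$ is a homeomorphism. A fan $\Sigma$ in $N_{\mathbb R}$ is a finite polyhedral complex of strictly convex rational polyhedral cones; it is complete if its support $|\Sigma|$ is $N_{\mathbb R}$. $N_\Sigma=\coprod_{\sigma\in\Sigma}N(\sigma)$, $N(\sigma)=N_{\mathbb R}/\langle\sigma\rangle_{\mathbb R}$, with quotient maps $\pi_\sigma:N_{\mathbb R}\to N(\sigma)$; a basis of open neighbourhoods of $p\in N(\sigma)$ is given by $\coprod_{\tau\prec\sigma}\pi_\tau(\Omega+\sigma)$ (union over faces $\tau$ of $\sigma$), where $\Omega$ runs over bounded open convex subsets of $N_{\mathbb R}$ with $p\in\pi_\sigma(\Omega)$. For $U\subset N_\Sigma$ open, $\varphi:U\to\mathbb R_{-\infty}$ is psh if (1) it is upper semicontinuous; (2) $\varphi|_{U\cap N_{\mathbb R}}$ is convex, i.e. $\varphi((1-t)x+ty)\le(1-t)\varphi(x)+t\varphi(y)$ for $t\in[0,1]$ whenever $[x,y]\subset U\cap N_{\mathbb R}$; (3) for $p\in N_{\mathbb R}$, $v\in|\Sigma|$ with $\{p+\mu v\mid\mu\in[0,\infty]\}\subset U$ one has $\varphi(p+\infty v)\le\varphi(p)$, where $p+\infty v=\lim_{\mu\to\infty}(p+\mu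 v)$ in $N_\Sigma$. *)

theory Defs
  imports "HOL-Analysis.Analysis"
begin

(* A free abelian group N of rank n is given as the integer span of n linearly independent
   vectors of some Euclidean space; N tensor R is then its real span.  Carrying N as a set,
   rather than fixing it to be the integer vectors of a type real^'n, keeps rank 0. *)

definition is_lattice :: "'a::euclidean_space set \<Rightarrow> bool" where
  "is_lattice N \<longleftrightarrow>
     (\<exists>B. finite B \<and> independent B \<and> N = range (\<lambda>c. \<Sum>b\<in>B. of_int (c b) *\<^sub>R b))"

abbreviation (input) lattice_real :: "'a::euclidean_space set \<Rightarrow> 'a set" where
  "lattice_real N \<equiv> span N"

definition rational_cone :: "'a::euclidean_space set \<Rightarrow> 'a set \<Rightarrow> bool" where
  "rational_cone N \<sigma> \<longleftrightarrow> (\<exists>S. finite S \<and> S \<subseteq> N \<and> \<sigma> = convex_cone hull S)"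

definition strictly_convex_cone :: "'a::euclidean_space set \<Rightarrow> bool" where
  "strictly_convex_cone \<sigma> \<longleftrightarrow> \<sigma> \<inter> uminus ` \<sigma> = {0}"

(* The library's face_of admits the empty face, which is not a face of a cone. *)
definition cone_face :: "'a::euclidean_space set \<Rightarrow> 'a set \<Rightarrow> bool" where
  "cone_face \<tau> \<sigma> \<longleftrightarrow> \<tau> face_of \<sigma> \<and> \<tau> \<noteq> {}"

definition fan :: "'a::euclidean_space set \<Rightarrow> 'a set set \<Rightarrow> bool" where
  "fan N \<Sigma> \<longleftrightarrow> finite \<Sigma>
     \<and> (\<forall>\<sigma>\<in>\<Sigma>. rational_cone N \<sigma> \<and> strictly_convex_cone \<sigma>)
     \<and> (\<forall>\<sigma>\<in>\<Sigma>. \<forall>\<tau>. cone_face \<tau> \<sigma> \<longrightarrow> \<tau> \<in> \<Sigma>)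
     \<and> (\<forall>\<sigma>\<in>\<Sigma>. \<forall>\<tau>\<in>\<Sigma>. cone_face (\<sigma> \<inter> \<tau>) \<sigma> \<and> cone_face (\<sigma> \<inter> \<tau>) \<tau>)"

definition fan_support :: "'a::euclidean_space set set \<Rightarrow> 'a set" where
  "fan_support \<Sigma> = \<Union>\<Sigma>"

definition complete_fan :: "'a::euclidean_space set \<Rightarrow> 'a set set \<Rightarrow> bool" where
  "complete_fan N \<Sigma> \<longleftrightarrow> fan N \<Sigma> \<and> fan_support \<Sigma> = lattice_real N"

definition quot_map :: "'a::euclidean_space set \<Rightarrow> 'a \<Rightarrow> 'a set" where
  "quot_map \<sigma> x = (+) x ` span \<sigma>"

definition stratum :: "'a::euclidean_space set \<Rightarrow> 'a set \<Rightarrow> 'a set set" where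
  "stratum N \<sigma> = quot_map \<sigma> ` lattice_real N"

(* Points are tagged by their cone: distinct cones may have the same span, so the union of
   the quotients would not be disjoint without the tag. *)
definition N_fan :: "'a::euclidean_space set \<Rightarrow> 'a set set \<Rightarrow> ('a set \<times> 'a set) set" where
  "N_fan N \<Sigma> = Sigma \<Sigma> (stratum N)"

(* The inclusion of the dense stratum, which belongs to the cone {0}. *)
definition embed :: "'a::euclidean_space \<Rightarrow> 'a set \<times> 'a set" where
  "embed x = ({0}, quot_map {0} x)"

definition bounded_open_convex :: "'a::euclidean_space set \<Rightarrow> 'a set \<Rightarrow> bool" where
  "bounded_open_convex N \<Omega> \<longleftrightarrow>
     bounded \<Omega> \<and> convex \<Omega> \<and> openin (top_of_set (lattice_real N)) \<Omega>"

definition basic_nbhd :: "'a::euclidean_space set \<Rightarrow> 'a set \<Rightarrow> ('a set \<times> 'a set) set" where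
  "basic_nbhd \<sigma> \<Omega> = Sigma {\<tau>. cone_face \<tau> \<sigma>} (\<lambda>\<tau>. quot_map \<tau> ` (\<Omega> + \<sigma>))"

definition fan_open :: "'a::euclidean_space set \<Rightarrow> 'a set set \<Rightarrow> ('a set \<times> 'a set) set \<Rightarrow> bool" where
  "fan_open N \<Sigma> U \<longleftrightarrow> U \<subseteq> N_fan N \<Sigma> \<and>
     (\<forall>(\<sigma>, p) \<in> U. \<exists>\<Omega>. bounded_open_convex N \<Omega> \<and> p \<in> quot_map \<sigma> ` \<Omega> \<and> basic_nbhd \<sigma> \<Omega> \<subseteq> U)"

definition fan_topology :: "'a::euclidean_space set \<Rightarrow> 'a set set \<Rightarrow> ('a set \<times> 'a set) topology" where
  "fan_topology N \<Sigma> = topology (fan_open N \<Sigma>)"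

definition usc_on :: "'b topology \<Rightarrow> 'b set \<Rightarrow> ('b \<Rightarrow> ereal) \<Rightarrow> bool" where
  "usc_on X U \<phi> \<longleftrightarrow> (\<forall>a. openin (subtopology X U) {p \<in> U. \<phi> p < a})"

(* Values in R together with -infinity are extended reals other than +infinity.  In the
   convexity inequality ereal multiplication gives 0 * (-infinity) = 0, so at t = 0 and t = 1
   the inequality is trivial.  In the last clause q plays the role of p + infinity v. *)
definition psh :: "'a::euclidean_space set \<Rightarrow> 'a set set \<Rightarrow> ('a set \<times> 'a set) set
    \<Rightarrow> ('a set \<times> 'a set \<Rightarrow> ereal) \<Rightarrow> bool" where
  "psh N \<Sigma> U \<phi> \<longleftrightarrow>
     openin (fan_topology N \<Sigma>) U
     \<and> (\<forall>p\<in>U. \<phi> p \<noteq> \<infinity>)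
     \<and> usc_on (fan_topology N \<Sigma>) U \<phi>
     \<and> (\<forall>x\<in>lattice_real N. \<forall>y\<in>lattice_real N. embed ` closed_segment x y \<subseteq> U \<longrightarrow>
          (\<forall>t\<in>{0..1::real}. \<phi> (embed ((1 - t) *\<^sub>R x + t *\<^sub>R y))
             \<le> ereal (1 - t) * \<phi> (embed x) + ereal t * \<phi> (embed y)))
     \<and> (\<forall>p\<in>lattice_real N. \<forall>v\<in>fan_support \<Sigma>. \<forall>q.
          limitin (fan_topology N \<Sigma>) (\<lambda>\<mu>::real. embed (p + \<mu> *\<^sub>R v)) q at_top \<longrightarrow>
          (\<forall>\<mu>\<ge>0. embed (p + \<mu> *\<^sub>R v) \<in> U) \<and> q \<in> U \<longrightarrow> \<phi> q \<le> \<phi> (embed p))"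

lemma span_convex_cone_diff:
  assumes "convex_cone \<sigma>" "x \<in> span \<sigma>"
  obtains a b where "a \<in> \<sigma>" "b \<in> \<sigma>" "x = a - b"
proof -
  have cc: "\<sigma> \<noteq> {}" "\<And>x y. x \<in> \<sigma> \<Longrightarrow> y \<in> \<sigma> \<Longrightarrow> x + y \<in> \<sigma>"
    "\<And>x c. x \<in> \<sigma> \<Longrightarrow> 0 \<le> c \<Longrightarrow> c *\<^sub>R x \<in> \<sigma>" "0 \<in> \<sigma>"
    using assms(1) convex_cone_contains_0[of \<sigma>] convex_cone_add[of \<sigma>]
    by (auto simp: convex_cone_def conic_def)
  have "\<exists>a\<in>\<sigma>. \<exists>b\<in>\<sigma>. x = a - b"
    using assms(2)
  proof (induction rule: span_induct_alt)
    case base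
    then show ?case using cc(4) by force
  next
    case (step c s y)
    then obtain a b where ab: "a \<in> \<sigma>" "b \<in> \<sigma>" "y = a - b" by blast
    show ?case
    proof (cases "c \<ge> 0")
      case True
      then show ?thesis
        using ab cc(2)[OF cc(3)[OF step(1) True] ab(1)]
        by (intro bexI[of _ "c *\<^sub>R s + a"] bexI[of _ b]) auto
    next
      case False
      then have "- c \<ge> 0" by simp
      then show ?thesis
        using ab cc(2)[OF cc(3)[OF step(1) \<open>- c \<ge> 0\<close>] ab(2)]
        by (intro bexI[of _ a] bexI[of _ "(- c) *\<^sub>R s + b"]) auto
    qed
  qed
  then show ?thesis using that by blast
qed

lemma quot_map_eq_iff: "quot_map \<sigma> x = quot_map \<sigma> y \<longleftrightarrow> x - y \<in> span \<sigma>"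
proof
  assume "quot_map \<sigma> x = quot_map \<sigma> y"
  then have "x + 0 \<in> (+) y ` span \<sigma>"
    unfolding quot_map_def using span_zero by blast
  then show "x - y \<in> span \<sigma>" by auto
next
  have sub: "quot_map \<sigma> x \<subseteq> quot_map \<sigma> y" if "x - y \<in> span \<sigma>" for x y
  proof
    fix z assume "z \<in> quot_map \<sigma> x"
    then obtain w where w: "w \<in> span \<sigma>" "z = x + w" unfolding quot_map_def by auto
    have "z = y + ((x - y) + w)" using w by simp
    then show "z \<in> quot_map \<sigma> y"
      unfolding quot_map_def using span_add[OF that w(1)] by (metis image_eqI)
  qed
  assume "x - y \<in> span \<sigma>"
  moreover from this have "y - x \<in> span \<sigma>" using span_neg by fastforce
  ultimately show "quot_map \<sigma> x = quot_map \<sigma> y" using sub by blast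
qed

lemma rational_cone_props:
  assumes "rational_cone N \<sigma>"
  shows "convex_cone \<sigma>" "\<sigma> \<subseteq> lattice_real N"
proof -
  obtain S where S: "S \<subseteq> N" "\<sigma> = convex_cone hull S"
    using assms unfolding rational_cone_def by blast
  show "convex_cone \<sigma>" using S by (simp add: convex_cone_convex_cone_hull)
  have "convex_cone (span N)"
    using span_zero[of N] by (auto simp: convex_cone_def conic_def span_scale subspace_imp_convex)
  then show "\<sigma> \<subseteq> span N"
    using S by (metis hull_minimal order_trans span_superset)
qed

lemma cone_face_trans:
  assumes "cone_face \<rho> \<tau>" "cone_face \<tau> \<sigma>"
  shows "cone_face \<rho> \<sigma>"
  using assms face_of_trans unfolding cone_face_def by blast

lemma basic_nbhd_mono:
  assumes "\<Omega> \<subseteq> \<Omega>' + \<sigma>" "convex_cone \<sigma>" "cone_face \<tau> \<sigma>"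
  shows "basic_nbhd \<tau> \<Omega> \<subseteq> basic_nbhd \<sigma> \<Omega>'"
proof -
  have "\<Omega> + \<tau> \<subseteq> \<Omega>' + \<sigma>"
  proof
    fix z assume "z \<in> \<Omega> + \<tau>"
    then obtain x t where "x \<in> \<Omega>" "t \<in> \<tau>" "z = x + t" by (auto elim: set_plus_elim)
    moreover from this obtain y s where "y \<in> \<Omega>'" "s \<in> \<sigma>" "x = y + s"
      using assms(1) by (auto elim!: set_plus_elim)
    moreover have "t \<in> \<sigma>"
      using \<open>t \<in> \<tau>\<close> assms(3) unfolding cone_face_def by (meson face_of_imp_subset subsetD)
    ultimately have "s + t \<in> \<sigma>" "z = y + (s + t)" "y \<in> \<Omega>'"
      using convex_cone_add[OF assms(2)] by (auto simp: add.assoc)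
    then show "z \<in> \<Omega>' + \<sigma>" by (metis set_plus_intro)
  qed
  then show ?thesis
    using cone_face_trans[OF _ assms(3)] unfolding basic_nbhd_def by blast
qed

lemma cone_face_refl: "convex_cone \<sigma> \<Longrightarrow> cone_face \<sigma> \<sigma>"
  by (auto simp: cone_face_def convex_cone_def intro: face_of_refl)

lemma bounded_open_convex_ball:
  assumes "y \<in> lattice_real N" "e > 0"
  shows "bounded_open_convex N (lattice_real N \<inter> ball y e)"
  unfolding bounded_open_convex_def
  by (auto simp: openin_open bounded_Int intro!: convex_Int subspace_imp_convex[OF subspace_span])

lemma openin_translation_span:
  fixes N :: "'a::euclidean_space set"
  assumes "openin (top_of_set (span N)) \<Omega>" "s \<in> span N"
  shows "openin (top_of_set (span N)) ((+) s ` \<Omega>)"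
proof -
  obtain T where T: "open T" "\<Omega> = span N \<inter> T" using assms(1) by (auto simp: openin_open)
  have "(+) s ` \<Omega> = span N \<inter> (+) s ` T"
  proof (intro equalityI subsetI)
    fix z assume "z \<in> (+) s ` \<Omega>"
    then show "z \<in> span N \<inter> (+) s ` T" using T assms(2) by (auto intro: span_add)
  next
    fix z assume "z \<in> span N \<inter> (+) s ` T"
    then obtain t where "t \<in> T" "z = s + t" "z \<in> span N" by auto
    moreover from this have "t \<in> span N" using span_diff[OF _ assms(2), of z] by simp
    ultimately show "z \<in> (+) s ` \<Omega>" using T by auto
  qed
  then show ?thesis using open_translation[OF T(1), of s] unfolding openin_open by blast
qed

lemma istopology_fan_open:
  assumes "fan N \<Sigma>"
  shows "istopology (fan_open N \<Sigma>)"
proof -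
  have int: "fan_open N \<Sigma> (U \<inter> V)" if U: "fan_open N \<Sigma> U" and V: "fan_open N \<Sigma> V" for U V
    unfolding fan_open_def
  proof (intro conjI ballI)
    show "U \<inter> V \<subseteq> N_fan N \<Sigma>" using U unfolding fan_open_def by blast
    fix z assume z: "z \<in> U \<inter> V"
    obtain \<sigma> p where zp: "z = (\<sigma>, p)" by (cases z)
    obtain \<Omega>1 where 1: "bounded_open_convex N \<Omega>1" "p \<in> quot_map \<sigma> ` \<Omega>1" "basic_nbhd \<sigma> \<Omega>1 \<subseteq> U"
      using U z zp unfolding fan_open_def by fast
    obtain \<Omega>2 where 2: "bounded_open_convex N \<Omega>2" "p \<in> quot_map \<sigma> ` \<Omega>2" "basic_nbhd \<sigma> \<Omega>2 \<subseteq> V"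
      using V z zp unfolding fan_open_def by fast
    have "\<sigma> \<in> \<Sigma>" using U z zp unfolding fan_open_def N_fan_def by blast
    then have rc: "rational_cone N \<sigma>" using assms unfolding fan_def by blast
    note cc = rational_cone_props[OF rc]
    obtain x1 x2 where x: "x1 \<in> \<Omega>1" "x2 \<in> \<Omega>2" "p = quot_map \<sigma> x1" "p = quot_map \<sigma> x2"
      using 1 2 by blast
    then have "x1 - x2 \<in> span \<sigma>" using quot_map_eq_iff by blast
    then obtain a b where ab: "a \<in> \<sigma>" "b \<in> \<sigma>" "x1 - x2 = a - b"
      using span_convex_cone_diff[OF cc(1)] by metis
    define y where "y = x1 + b"
    have y2: "y = x2 + a" using ab unfolding y_def by (simp add: algebra_simps)
    let ?A = "(+) b ` \<Omega>1 \<inter> (+) a ` \<Omega>2"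
    have "b \<in> span N" "a \<in> span N" using ab cc by auto
    then have "bounded_open_convex N ?A"
      using 1(1) 2(1) openin_translation_span[of N \<Omega>1 b] openin_translation_span[of N \<Omega>2 a]
      unfolding bounded_open_convex_def
      by (auto intro!: convex_Int bounded_Int openin_Int convex_translation bounded_translation)
    moreover have "y \<in> ?A" 
    proof
      show "y \<in> (+) b ` \<Omega>1" using x(1) y_def by (metis add.commute image_eqI)
      show "y \<in> (+) a ` \<Omega>2" using x(2) y2 by (metis add.commute image_eqI)
    qed
    moreover have "p = quot_map \<sigma> y"
      using x(3) quot_map_eq_iff[of \<sigma> x1 y] span_neg[OF span_base[OF ab(2)]]
      by (simp add: y_def)
    moreover have "?A \<subseteq> \<Omega>1 + \<sigma>" "?A \<subseteq> \<Omega>2 + \<sigma>"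
      using ab by (auto simp: add.commute intro: set_plus_intro)
    then have "basic_nbhd \<sigma> ?A \<subseteq> U \<inter> V"
      using basic_nbhd_mono[OF _ cc(1) cone_face_refl[OF cc(1)]] 1(3) 2(3) by blast
    ultimately show "case z of (\<sigma>, p) \<Rightarrow> \<exists>\<Omega>. bounded_open_convex N \<Omega> \<and> p \<in> quot_map \<sigma> ` \<Omega>
        \<and> basic_nbhd \<sigma> \<Omega> \<subseteq> U \<inter> V"
      unfolding zp by blast
  qed
  have "fan_open N \<Sigma> (\<Union>K)" if "\<forall>k\<in>K. fan_open N \<Sigma> k" for K
    unfolding fan_open_def
  proof (intro conjI ballI)
    show "\<Union>K \<subseteq> N_fan N \<Sigma>" using that unfolding fan_open_def by blast
    fix z assume "z \<in> \<Union>K"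
    then obtain k where k: "k \<in> K" "z \<in> k" by blast
    obtain \<sigma> p where z: "z = (\<sigma>, p)" by (cases z)
    have "\<exists>\<Omega>. bounded_open_convex N \<Omega> \<and> p \<in> quot_map \<sigma> ` \<Omega> \<and> basic_nbhd \<sigma> \<Omega> \<subseteq> k"
      using that k z unfolding fan_open_def by fast
    then show "case z of (\<sigma>, p) \<Rightarrow> \<exists>\<Omega>. bounded_open_convex N \<Omega> \<and> p \<in> quot_map \<sigma> ` \<Omega>
        \<and> basic_nbhd \<sigma> \<Omega> \<subseteq> \<Union>K"
      using k z by blast
  qed
  with int show ?thesis unfolding istopology_def by blast
qed

lemma openin_fan_topology:
  assumes "fan N \<Sigma>"
  shows "openin (fan_topology N \<Sigma>) U \<longleftrightarrow> fan_open N \<Sigma> U"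
  using istopology_fan_open[OF assms] unfolding fan_topology_def by simp

lemma openin_basic_nbhd:
  assumes f: "fan N \<Sigma>" and s: "\<sigma> \<in> \<Sigma>" and O: "bounded_open_convex N \<Omega>"
  shows "openin (fan_topology N \<Sigma>) (basic_nbhd \<sigma> \<Omega>)"
  unfolding openin_fan_topology[OF f] fan_open_def
proof (intro conjI ballI)
  have rc: "rational_cone N \<sigma>" using f s unfolding fan_def by blast
  note cc = rational_cone_props[OF rc]
  have O': "\<Omega> \<subseteq> span N" using O openin_imp_subset unfolding bounded_open_convex_def by blast
  have "\<Omega> + \<sigma> \<subseteq> span N"
    using O' cc(2) by (auto elim!: set_plus_elim intro: span_add)
  then show "basic_nbhd \<sigma> \<Omega> \<subseteq> N_fan N \<Sigma>"
    using f s unfolding basic_nbhd_def N_fan_def fan_def stratum_def by blast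
  fix z assume "z \<in> basic_nbhd \<sigma> \<Omega>"
  then obtain \<tau> x t where z: "z = (\<tau>, quot_map \<tau> (x + t))" "cone_face \<tau> \<sigma>" "x \<in> \<Omega>" "t \<in> \<sigma>"
    unfolding basic_nbhd_def by (auto elim!: set_plus_elim)
  have "t \<in> span N" using z cc by auto
  then have "bounded_open_convex N ((+) t ` \<Omega>)"
    using O openin_translation_span[of N \<Omega> t] unfolding bounded_open_convex_def
    by (auto intro!: convex_translation bounded_translation)
  moreover have "(+) t ` \<Omega> \<subseteq> \<Omega> + \<sigma>"
    using z by (auto simp: add.commute intro: set_plus_intro)
  then have "basic_nbhd \<tau> ((+) t ` \<Omega>) \<subseteq> basic_nbhd \<sigma> \<Omega>"
    using basic_nbhd_mono cc(1) z(2) by blast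
  moreover have "quot_map \<tau> (x + t) \<in> quot_map \<tau> ` (+) t ` \<Omega>"
    using z by (auto simp: add.commute)
  ultimately show "case z of (\<tau>, p) \<Rightarrow> \<exists>\<Omega>'. bounded_open_convex N \<Omega>' \<and> p \<in> quot_map \<tau> ` \<Omega>'
      \<and> basic_nbhd \<tau> \<Omega>' \<subseteq> basic_nbhd \<sigma> \<Omega>"
    unfolding z(1) by blast
qed

lemma topspace_fan_topology:
  assumes f: "fan N \<Sigma>"
  shows "topspace (fan_topology N \<Sigma>) = N_fan N \<Sigma>"
proof (rule antisym)
  show "topspace (fan_topology N \<Sigma>) \<subseteq> N_fan N \<Sigma>"
    using openin_topspace[of "fan_topology N \<Sigma>"] unfolding openin_fan_topology[OF f] fan_open_def
    by blast
  show "N_fan N \<Sigma> \<subseteq> topspace (fan_topology N \<Sigma>)"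
  proof
    fix z assume "z \<in> N_fan N \<Sigma>"
    then obtain \<sigma> x where z: "z = (\<sigma>, quot_map \<sigma> x)" "\<sigma> \<in> \<Sigma>" "x \<in> span N"
      unfolding N_fan_def stratum_def by blast
    have cc: "convex_cone \<sigma>" using rational_cone_props f z unfolding fan_def by blast
    let ?O = "span N \<inter> ball x 1"
    have "x + 0 \<in> ?O + \<sigma>"
      using z convex_cone_contains_0[OF cc] by (intro set_plus_intro) auto
    then have "z \<in> basic_nbhd \<sigma> ?O"
      using cone_face_refl[OF cc] unfolding basic_nbhd_def z(1) by simp
    then show "z \<in> topspace (fan_topology N \<Sigma>)"
      using openin_basic_nbhd[OF f z(2) bounded_open_convex_ball[OF z(3), of 1]] openin_subset
      by fastforce
  qed
qed

lemma cone_face_zero: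
  assumes cc: "convex_cone \<sigma>" and sc: "strictly_convex_cone \<sigma>"
  shows "cone_face {0} \<sigma>"
proof -
  have mul: "c *\<^sub>R x \<in> \<sigma>" if "x \<in> \<sigma>" "0 \<le> c" for x c
    using cc that by (auto simp: convex_cone_def conic_def)
  have zero: "x = 0" if "x \<in> \<sigma>" "- x \<in> \<sigma>" for x
  proof -
    have "x \<in> \<sigma> \<inter> uminus ` \<sigma>" using that by (auto intro: image_eqI[of _ _ "- x"])
    then show ?thesis using sc unfolding strictly_convex_cone_def by blast
  qed
  have end0: "a = 0"
    if "a \<in> \<sigma>" "b \<in> \<sigma>" "0 < u" "u < 1" "(1 - u) *\<^sub>R a + u *\<^sub>R b = 0" for a b u
  proof -
    have "- ((1 - u) *\<^sub>R a) = u *\<^sub>R b"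
      using that(5) by (simp add: minus_unique)
    then have "(1 - u) *\<^sub>R a = 0"
      using zero[OF mul[OF that(1), of "1 - u"]] mul[OF that(2), of u] that by simp
    then show ?thesis using that by simp
  qed
  have "{0} face_of \<sigma>"
    unfolding face_of_def
  proof (intro conjI ballI impI)
    show "{0} \<subseteq> \<sigma>" using convex_cone_contains_0[OF cc] by simp
    fix a b x assume h: "a \<in> \<sigma>" "b \<in> \<sigma>" "x \<in> {0}" "x \<in> open_segment a b"
    then obtain u where u: "0 < u" "u < 1" "(1 - u) *\<^sub>R a + u *\<^sub>R b = 0"
      by (auto simp: in_segment)
    show "a \<in> {0}" using end0[OF h(1,2) u] by simp
    show "b \<in> {0}" using end0[OF h(2,1), of "1 - u"] u by (simp add: add.commute)
  qed simp
  then show ?thesis by (simp add: cone_face_def)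
qed

(* Each v in the support of a fan lies in the relative interior of one of its cones, so the
   limit in the last clause of psh exists. *)
lemma limitin_embed:
  assumes f: "fan N \<Sigma>" and s: "\<sigma> \<in> \<Sigma>" and v: "v \<in> rel_interior \<sigma>" and p: "p \<in> lattice_real N"
  shows "limitin (fan_topology N \<Sigma>) (\<lambda>\<mu>. embed (p + \<mu> *\<^sub>R v)) (\<sigma>, quot_map \<sigma> p) at_top"
  unfolding limitin_def
proof (intro conjI allI impI)
  show "(\<sigma>, quot_map \<sigma> p) \<in> topspace (fan_topology N \<Sigma>)"
    unfolding topspace_fan_topology[OF f] N_fan_def stratum_def using s p by blast
  fix U assume "openin (fan_topology N \<Sigma>) U \<and> (\<sigma>, quot_map \<sigma> p) \<in> U"
  then obtain \<Omega> x where x: "x \<in> \<Omega>" "quot_map \<sigma> p = quot_map \<sigma> x" "basic_nbhd \<sigma> \<Omega> \<subseteq> U"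
    unfolding openin_fan_topology[OF f] fan_open_def by blast
  have cc: "convex_cone \<sigma>" and sc: "strictly_convex_cone \<sigma>"
    using rational_cone_props f s unfolding fan_def by blast+
  have d: "p - x \<in> span \<sigma>" using x(2) quot_map_eq_iff by blast
  have aff: "affine hull \<sigma> = span \<sigma>"
    by (rule affine_hull_span_0[OF hull_inc[OF convex_cone_contains_0[OF cc]]])
  obtain e where e: "e > 0" "ball v e \<inter> span \<sigma> \<subseteq> \<sigma>" "v \<in> \<sigma>"
    using v unfolding mem_rel_interior_ball aff by auto
  have "((\<lambda>\<mu>. v + inverse \<mu> *\<^sub>R (p - x)) \<longlongrightarrow> v + 0 *\<^sub>R (p - x)) at_top"
    by (intro tendsto_intros tendsto_inverse_0_at_top filterlim_ident)
  then have "eventually (\<lambda>\<mu>. v + inverse \<mu> *\<^sub>R (p - x) \<in> ball v e) at_top"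
    by (rule topological_tendstoD) (use e(1) in auto)
  then show "eventually (\<lambda>\<mu>. embed (p + \<mu> *\<^sub>R v) \<in> U) at_top"
    using eventually_gt_at_top[of 0]
  proof eventually_elim
    case (elim \<mu>)
    have "v + inverse \<mu> *\<^sub>R (p - x) \<in> \<sigma>"
      using e elim(1) span_add[OF span_base[OF e(3)] span_scale[OF d]] by blast
    then have "\<mu> *\<^sub>R (v + inverse \<mu> *\<^sub>R (p - x)) \<in> \<sigma>"
      using cc elim(2) by (auto simp: convex_cone_def conic_def)
    then have "x + \<mu> *\<^sub>R (v + inverse \<mu> *\<^sub>R (p - x)) \<in> \<Omega> + \<sigma>"
      using set_plus_intro[OF x(1)] by blast
    moreover have "x + \<mu> *\<^sub>R (v + inverse \<mu> *\<^sub>R (p - x)) = p + \<mu> *\<^sub>R v"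
      using elim(2) by (simp add: scaleR_add_right)
    ultimately show "embed (p + \<mu> *\<^sub>R v) \<in> U"
      using x(3) cone_face_zero[OF cc sc] unfolding embed_def basic_nbhd_def by auto
  qed
qed

end

theory Submission
  imports Defs
begin

text \<open>
  Fix a psh function \<open>\<phi>\<close> and points \<open>x\<close>, \<open>y\<close> of the dense stratum. As the fan is complete, the ray
  from \<open>x\<close> through \<open>y\<close> points in a direction of the support, so it converges to a boundary point
  \<open>q\<close>, and \<open>\<phi> q \<le> \<phi> x\<close> by the third condition on psh functions. Upper semicontinuity at \<open>q\<close> then
  bounds \<open>\<phi>\<close> by any prescribed \<open>a > \<phi> x\<close> far out on the ray. The point \<open>y\<close> lies between \<open>x\<close> and such
  a far point, so convexity gives \<open>\<phi> y \<le> a\<close>; hence \<open>\<phi> y \<le> \<phi> x\<close>, and by symmetry \<open>\<phi>\<close> is constant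
  on the dense stratum (lemma \<open>psh_embed_le\<close>). This argument compares values with bounds only,
  so it covers the value \<open>- \<infinity>\<close> as well.

  Every point of a boundary stratum is the end of such a ray. There \<open>\<phi>\<close> is at most the constant
  by the third condition, and at least the constant by upper semicontinuity.
\<close>

lemma zero_cone_in_fan:
  assumes f: "fan N \<Sigma>" and s: "\<sigma> \<in> \<Sigma>"
  shows "{0} \<in> \<Sigma>"
proof -
  have "cone_face {0} \<sigma>"
    using f s rational_cone_props(1) unfolding fan_def by (blast intro: cone_face_zero)
  then show ?thesis
    using f s unfolding fan_def by blast
qed

lemma embed_in_N_fan:
  assumes "fan N \<Sigma>" "\<Sigma> \<noteq> {}" "x \<in> lattice_real N"
  shows "embed x \<in> N_fan N \<Sigma>"
  using assms zero_cone_in_fan unfolding embed_def N_fan_def stratum_def by blast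

text \<open>
  A cone of the fan that is minimal among those containing \<open>v\<close> has \<open>v\<close> in its relative interior:
  otherwise a supporting hyperplane at \<open>v\<close> would cut out a smaller face containing \<open>v\<close>. The
  relative interior matters because a ray with direction \<open>v\<close> ends in the stratum of exactly this cone.
\<close>

lemma fan_support_rel_interior:
  assumes f: "fan N \<Sigma>" and v: "v \<in> fan_support \<Sigma>"
  obtains \<sigma> where "\<sigma> \<in> \<Sigma>" "v \<in> rel_interior \<sigma>"
proof -
  have "finite {\<sigma> \<in> \<Sigma>. v \<in> \<sigma>}" "{\<sigma> \<in> \<Sigma>. v \<in> \<sigma>} \<noteq> {}"
    using f v unfolding fan_def fan_support_def by auto
  then obtain \<sigma> where \<sigma>: "\<sigma> \<in> \<Sigma>" "v \<in> \<sigma>"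
    and min: "\<And>\<tau>. \<tau> \<in> \<Sigma> \<Longrightarrow> v \<in> \<tau> \<Longrightarrow> \<tau> \<subseteq> \<sigma> \<Longrightarrow> \<tau> = \<sigma>"
    using finite_has_minimal[of "{\<sigma> \<in> \<Sigma>. v \<in> \<sigma>}"] by auto
  have cvx: "convex \<sigma>"
    using f \<sigma>(1) rational_cone_props(1) unfolding fan_def convex_cone_def by blast
  have "v \<in> rel_interior \<sigma>"
  proof (rule ccontr)
    assume "v \<notin> rel_interior \<sigma>"
    then obtain a where ge: "\<And>y. y \<in> \<sigma> \<Longrightarrow> a \<bullet> v \<le> a \<bullet> y"
      and gt: "\<And>y. y \<in> rel_interior \<sigma> \<Longrightarrow> a \<bullet> v < a \<bullet> y"
      using supporting_hyperplane_rel_boundary[OF cvx \<sigma>(2)] by metis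
    let ?\<tau> = "\<sigma> \<inter> {y. a \<bullet> y = a \<bullet> v}"
    have "?\<tau> face_of \<sigma>"
      using ge by (intro face_of_Int_supporting_hyperplane_ge[OF cvx])
    then have "?\<tau> \<in> \<Sigma>"
      using f \<sigma> unfolding fan_def cone_face_def by blast
    then have "?\<tau> = \<sigma>"
      using min \<sigma>(2) by auto
    moreover obtain w where "w \<in> rel_interior \<sigma>"
      using rel_interior_eq_empty[OF cvx] \<sigma>(2) by blast
    ultimately have "a \<bullet> w = a \<bullet> v"
      using rel_interior_subset[of \<sigma>] by blast
    then show False
      using gt[OF \<open>w \<in> rel_interior \<sigma>\<close>] by simp
  qed
  then show ?thesis
    using that \<sigma>(1) by blast
qed

lemma usc_on_limitin_less:
  assumes usc: "usc_on X U \<phi>" and lim: "limitin X g q F" and U: "openin X U"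
    and q: "q \<in> U" "\<phi> q < a"
  shows "eventually (\<lambda>\<mu>. \<phi> (g \<mu>) < a) F"
proof -
  have "openin X {p \<in> U. \<phi> p < a}"
    using usc U unfolding usc_on_def by (auto intro: openin_trans_full)
  then have "eventually (\<lambda>\<mu>. g \<mu> \<in> {p \<in> U. \<phi> p < a}) F"
    using lim q unfolding limitin_def by blast
  then show ?thesis
    by (rule eventually_mono) auto
qed

text \<open>
  The end of a ray is controlled from both sides: the second conclusion pushes the bound
  \<open>\<phi> q < a\<close> from the end \<open>q\<close> back onto the ray.
\<close>

lemma psh_ray_end:
  assumes f: "fan N \<Sigma>" and psh: "psh N \<Sigma> (N_fan N \<Sigma>) \<phi>" and s: "\<sigma> \<in> \<Sigma>"
    and v: "v \<in> rel_interior \<sigma>" and p: "p \<in> lattice_real N"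
  shows "\<phi> (\<sigma>, quot_map \<sigma> p) \<le> \<phi> (embed p)"
    and "\<phi> (\<sigma>, quot_map \<sigma> p) < a \<Longrightarrow> eventually (\<lambda>\<mu>. \<phi> (embed (p + \<mu> *\<^sub>R v)) < a) at_top"
proof -
  note lim = limitin_embed[OF f s v p]
  have q: "(\<sigma>, quot_map \<sigma> p) \<in> N_fan N \<Sigma>"
    using s p unfolding N_fan_def stratum_def by blast
  have v\<sigma>: "v \<in> \<sigma>"
    using v rel_interior_subset by blast
  then have vN: "v \<in> lattice_real N"
    using f s rational_cone_props(2) unfolding fan_def by blast
  have ray: "embed (p + \<mu> *\<^sub>R v) \<in> N_fan N \<Sigma>" for \<mu>
    using s by (intro embed_in_N_fan[OF f] span_add[OF p] span_scale[OF vN]) auto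
  have "v \<in> fan_support \<Sigma>"
    using s v\<sigma> unfolding fan_support_def by blast
  then show "\<phi> (\<sigma>, quot_map \<sigma> p) \<le> \<phi> (embed p)"
    using psh p lim q ray unfolding psh_def by blast
  assume "\<phi> (\<sigma>, quot_map \<sigma> p) < a"
  then show "eventually (\<lambda>\<mu>. \<phi> (embed (p + \<mu> *\<^sub>R v)) < a) at_top"
    using psh usc_on_limitin_less[OF _ lim _ q] unfolding psh_def by blast
qed

lemma ereal_convex_combination_le:
  fixes u w :: ereal
  assumes "u \<le> ereal b" "w \<le> ereal b" "0 \<le> t" "t \<le> 1"
  shows "ereal (1 - t) * u + ereal t * w \<le> ereal b"
proof -
  have "ereal (1 - t) * u + ereal t * w \<le> ereal (1 - t) * ereal b + ereal t * ereal b"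
    using assms by (intro add_mono ereal_mult_left_mono) auto
  also have "\<dots> = ereal b"
    by (simp add: algebra_simps)
  finally show ?thesis .
qed

lemma psh_embed_le:
  assumes cf: "complete_fan N \<Sigma>" and psh: "psh N \<Sigma> (N_fan N \<Sigma>) \<phi>"
    and x: "x \<in> lattice_real N" and y: "y \<in> lattice_real N"
  shows "\<phi> (embed y) \<le> \<phi> (embed x)"
proof (rule dense_ge)
  fix a assume a: "\<phi> (embed x) < a"
  have f: "fan N \<Sigma>" and supp: "fan_support \<Sigma> = lattice_real N"
    using cf unfolding complete_fan_def by auto
  have vN: "y - x \<in> lattice_real N"
    using x y span_diff by blast
  then obtain \<sigma> where s: "\<sigma> \<in> \<Sigma>" "y - x \<in> rel_interior \<sigma>"
    using fan_support_rel_interior[OF f] supp by blast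
  have "\<phi> (\<sigma>, quot_map \<sigma> x) < a"
    using psh_ray_end(1)[OF f psh s x] a by order
  then have "eventually (\<lambda>\<mu>. \<phi> (embed (x + \<mu> *\<^sub>R (y - x))) < a) at_top"
    by (rule psh_ray_end(2)[OF f psh s x])
  then have "eventually (\<lambda>\<mu>. \<phi> (embed (x + \<mu> *\<^sub>R (y - x))) < a \<and> \<mu> \<ge> 1) at_top"
    by (intro eventually_conj eventually_ge_at_top)
  then obtain \<mu> where \<mu>: "\<phi> (embed (x + \<mu> *\<^sub>R (y - x))) < a" "\<mu> \<ge> 1"
    by (auto dest: eventually_happens)
  define z where "z = x + \<mu> *\<^sub>R (y - x)"
  define t where "t = 1 / \<mu>"
  have t: "0 \<le> t" "t \<le> 1"
    using \<mu>(2) by (auto simp: t_def)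
  have zN: "z \<in> lattice_real N"
    unfolding z_def by (intro span_add[OF x] span_scale[OF vN])
  have "(1 - t) *\<^sub>R x + t *\<^sub>R z = x + (t * \<mu>) *\<^sub>R (y - x)"
    unfolding z_def by (simp add: algebra_simps)
  then have yz: "y = (1 - t) *\<^sub>R x + t *\<^sub>R z"
    using \<mu>(2) by (simp add: t_def)
  have "closed_segment x z \<subseteq> lattice_real N"
    using x zN by (intro closed_segment_subset subspace_imp_convex[OF subspace_span])
  then have "embed ` closed_segment x z \<subseteq> N_fan N \<Sigma>"
    using embed_in_N_fan[OF f] s(1) by blast
  then have conv: "\<phi> (embed y) \<le> ereal (1 - t) * \<phi> (embed x) + ereal t * \<phi> (embed z)"
    using psh x zN t unfolding psh_def yz by auto
  show "\<phi> (embed y) \<le> a"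
  proof (cases a)
    case (real b)
    have "\<phi> (embed x) \<le> ereal b" "\<phi> (embed z) \<le> ereal b"
      using a \<mu>(1) unfolding real z_def by auto
    then show ?thesis
      using conv ereal_convex_combination_le[OF _ _ t] unfolding real by (blast intro: order_trans)
  qed (use a in auto)
qed

theorem proposition3p1p9:
  fixes N :: "'a::euclidean_space set"
    and \<Sigma> :: "'a set set"
    and \<phi> :: "'a set \<times> 'a set \<Rightarrow> ereal"
  assumes "is_lattice N"
    and "complete_fan N \<Sigma>"
    and "psh N \<Sigma> (N_fan N \<Sigma>) \<phi>"
  shows "\<phi> constant_on N_fan N \<Sigma>"
proof -
  note cf = assms(2) and psh = assms(3)
  have f: "fan N \<Sigma>"
    using cf unfolding complete_fan_def by simp
  have const: "\<phi> (embed x) = \<phi> (embed 0)" if "x \<in> lattice_real N" for x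
    by (intro antisym psh_embed_le[OF cf psh] that span_zero)
  have "\<phi> q = \<phi> (embed 0)" if q: "q \<in> N_fan N \<Sigma>" for q
  proof -
    obtain \<sigma> p where q: "q = (\<sigma>, quot_map \<sigma> p)" "\<sigma> \<in> \<Sigma>" and p: "p \<in> lattice_real N"
      using q unfolding N_fan_def stratum_def by blast
    have cc: "convex_cone \<sigma>" and \<sigma>N: "\<sigma> \<subseteq> lattice_real N"
      using f q(2) rational_cone_props unfolding fan_def by blast+
    obtain v where v: "v \<in> rel_interior \<sigma>"
      using cc rel_interior_eq_empty[of \<sigma>] unfolding convex_cone_def by auto
    have vN: "v \<in> lattice_real N"
      using v rel_interior_subset \<sigma>N by blast
    show ?thesis
    proof (rule antisym)
      show "\<phi> q \<le> \<phi> (embed 0)"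
        using psh_ray_end(1)[OF f psh q(2) v p] const[OF p] q(1) by simp
      show "\<phi> (embed 0) \<le> \<phi> q"
      proof (rule dense_ge)
        fix a assume "\<phi> q < a"
        then have "eventually (\<lambda>\<mu>. \<phi> (embed (p + \<mu> *\<^sub>R v)) < a) at_top"
          using psh_ray_end(2)[OF f psh q(2) v p] q(1) by blast
        then obtain \<mu> where "\<phi> (embed (p + \<mu> *\<^sub>R v)) < a"
          by (auto dest: eventually_happens)
        then show "\<phi> (embed 0) \<le> a"
          using const[OF span_add[OF p span_scale[OF vN]]] by simp
      qed
    qed
  qed
  then show ?thesis
    unfolding constant_on_def by blast
qed

end
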